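(* Let $\Gamma$ be a connected simple graph with vertices $v_1,\ldots,v_k$, and let $x_1,\ldots,x_k$ be positive integers. Let $\Gamma_{[x_1,\ldots,x_k]}$ be the clique--replaced graph (defined below), and put $$m_i=x_i+\sum_{v_j\in N_\Gamma(v_i)}x_j,\qquad \lambda_i=\frac{m_i}{x_i}\quad(i=1,\ldots,k),\qquad \Psi=\prod_{i=1}^k\lambda_i,\qquad n=x_1+\cdots+x_k .$$ Let $\mathbf{A}$ be the $k\times k$ adjacency matrix of the complement $\Gamma^c$ of $\Gamma$ (rows and columns indexed by $1,\ldots,k$ in the order $v_1,\ldots,v_k$), and for a nonempty subset $S\subseteq\{1,\ldots,k\}$ let $\mathbf{A}(S)$ be the principal submatrix of $\mathbf{A}$ with rows and columns indexed by $S$. Then the number of spanning trees of $\Gamma_{[x_1,\ldots,x_k]}$ is $$\kappa\left(\Gamma_{[x_1,\ldots,x_k]}\right)=\frac{\prod_{i=1}^{k}m_i^{x_i}}{\Psi\, n^2}\Big(\Psi+\sum_{\emptyset\neq S\subseteq\{1,\ldots,k\}}\det\mathbf{A}(S)\prod_{i\notin S}\lambda_i\Big).$$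
   Context: All graphs are simple. $N_\Gamma(v)$ denotes the set of neighbours of $v$ in $\Gamma$, and $\kappa(\cdot)$ denotes the number of spanning trees (the complexity) of a graph. The clique--replaced graph $\Gamma_{[x_1,\ldots,x_k]}$ is obtained from $\Gamma$ by replacing each vertex $v_i$ by a complete graph $K_{x_i}$ on $x_i$ new vertices, and, whenever $v_i$ and $v_j$ are adjacent in $\Gamma$, joining every vertex of the copy $K_{x_i}$ to every vertex of the copy $K_{x_j}$ (no other edges between different copies). The complement $\Gamma^c$ has the same vertex set as $\Gamma$, with two distinct vertices adjacent in $\Gamma^c$ iff they are not adjacent in $\Gamma$. *)

theory Defs
  imports Main "Jordan_Normal_Form.Determinant" "Jordan_Normal_Form.DL_Submatrix"
begin

text \<open>A graph is given by a vertex set V and an adjacency predicate adj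
(only its restriction to V matters). Edges are two-element sets.\<close>

definition graph_edges :: "'a set \<Rightarrow> ('a \<Rightarrow> 'a \<Rightarrow> bool) \<Rightarrow> 'a set set" where
  "graph_edges V adj = {{u, v} | u v. u \<in> V \<and> v \<in> V \<and> adj u v}"

definition simple_graph :: "'a set \<Rightarrow> ('a \<Rightarrow> 'a \<Rightarrow> bool) \<Rightarrow> bool" where
  "simple_graph V adj \<longleftrightarrow> finite V \<and> (\<forall>u\<in>V. \<not> adj u u) \<and>
     (\<forall>u\<in>V. \<forall>v\<in>V. adj u v \<longleftrightarrow> adj v u)"

definition connected_graph :: "'a set \<Rightarrow> ('a \<Rightarrow> 'a \<Rightarrow> bool) \<Rightarrow> bool" where
  "connected_graph V adj \<longleftrightarrow> V \<noteq> {} \<and>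
     (\<forall>u\<in>V. \<forall>v\<in>V. (\<lambda>a b. a \<in> V \<and> b \<in> V \<and> adj a b)\<^sup>*\<^sup>* u v)"

definition has_cycle :: "'a set \<Rightarrow> 'a set set \<Rightarrow> bool" where
  "has_cycle V T \<longleftrightarrow> (\<exists>cs. length cs \<ge> 3 \<and> distinct cs \<and> set cs \<subseteq> V \<and>
     (\<forall>i<length cs. {cs ! i, cs ! ((i + 1) mod length cs)} \<in> T))"

definition spanning_tree :: "'a set \<Rightarrow> ('a \<Rightarrow> 'a \<Rightarrow> bool) \<Rightarrow> 'a set set \<Rightarrow> bool" where
  "spanning_tree V adj T \<longleftrightarrow> T \<subseteq> graph_edges V adj \<and>
     connected_graph V (\<lambda>u v. {u, v} \<in> T) \<and> \<not> has_cycle V T"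

definition complexity :: "'a set \<Rightarrow> ('a \<Rightarrow> 'a \<Rightarrow> bool) \<Rightarrow> nat" where
  "complexity V adj = card {T. spanning_tree V adj T}"

text \<open>Clique-replaced graph of a graph on vertices 0..<k with adjacency E:
vertex v_i is replaced by the copies (i,a), a < x i.\<close>
definition cr_vertices :: "nat \<Rightarrow> (nat \<Rightarrow> nat) \<Rightarrow> (nat \<times> nat) set" where
  "cr_vertices k x = {(i, a). i < k \<and> a < x i}"

definition cr_adj :: "(nat \<Rightarrow> nat \<Rightarrow> bool) \<Rightarrow> nat \<times> nat \<Rightarrow> nat \<times> nat \<Rightarrow> bool" where
  "cr_adj E p q \<longleftrightarrow> (fst p = fst q \<and> snd p \<noteq> snd q) \<or> (fst p \<noteq> fst q \<and> E (fst p) (fst q))"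

definition compl_adj_mat :: "nat \<Rightarrow> (nat \<Rightarrow> nat \<Rightarrow> bool) \<Rightarrow> real mat" where
  "compl_adj_mat k E = mat k k (\<lambda>(i, j). if i \<noteq> j \<and> \<not> E i j then 1 else 0)"

end

theory Submission
  imports Defs
begin

text \<open>Let \<open>L\<close> be the Laplacian of the clique-replaced graph and \<open>J\<close> the all-ones matrix. The
  matrix-tree theorem gives \<open>det (L + J) = n\<^sup>2 \<kappa>\<close>, and \<open>L + J\<close> is the diagonal matrix of the
  \<open>m\<^sub>i\<close> (each repeated \<open>x\<^sub>i\<close> times) plus the adjacency matrix of the complement. The latter
  factors through the \<open>k\<close> blocks, so Sylvester's identity \<open>det (1 + XY) = det (1 + YX)\<close> reduces
  the determinant to \<open>det (diag \<lambda> + A)\<close> up to the factor \<open>\<Prod> m\<^sub>i ^ x\<^sub>i / \<Psi>\<close>, and this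
  determinant expands into principal minors of \<open>A\<close>.\<close>

section \<open>Determinants indexed by finite sets\<close>

text \<open>The Leibniz formula over an arbitrary finite index set, so that graph vertices need no
  enumeration.\<close>

definition fdet :: "'i set \<Rightarrow> ('i \<Rightarrow> 'i \<Rightarrow> 'a::comm_ring_1) \<Rightarrow> 'a" where
  "fdet S A = (\<Sum>p | p permutes S. of_int (sign p) * (\<Prod>i\<in>S. A i (p i)))"

lemma fdet_cong:
  assumes "\<And>i j. i \<in> S \<Longrightarrow> j \<in> S \<Longrightarrow> A i j = B i j"
  shows "fdet S A = fdet S B"
  unfolding fdet_def using assms
  by (intro sum.cong refl arg_cong2[of _ _ _ _ "(*)"] prod.cong) (auto simp: permutes_in_image)

text \<open>Conjugation by \<open>b\<close> is a sign-preserving bijection from the permutations of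
  the indices below \<open>n\<close> to those of \<open>S\<close>. Facts about \<open>det\<close>
  transfer to \<open>fdet\<close> along any enumeration \<open>b\<close>.\<close>

lemma fdet_eq_det:
  assumes b: "bij_betw b {0..<n} S"
  shows "fdet S A = det (mat n n (\<lambda>(i, j). A (b i) (b j)))"
proof -
  let ?N = "{0..<n}"
  have inj: "inj_on b ?N" using b by (rule bij_betw_imp_inj_on)
  let ?m = "map_permutation ?N b"
  have bij: "bij_betw ?m {p. p permutes ?N} {p. p permutes S}"
  proof (rule bij_betw_byWitness[where f' = "map_permutation S (inv_into ?N b)"])
    show "\<forall>p\<in>{p. p permutes ?N}. map_permutation S (inv_into ?N b) (?m p) = p"
      using b inj by (auto intro!: map_permutation_compose_inv)
    have "map_permutation ?N b (map_permutation S (inv_into ?N b) p) = p" if "p permutes S" for p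
      by (rule map_permutation_compose_inv[OF bij_betw_inv_into[OF b] that])
         (use b in \<open>auto simp: bij_betw_inv_into_right\<close>)
    then show "\<forall>p\<in>{p. p permutes S}. ?m (map_permutation S (inv_into ?N b) p) = p" by blast
    show "?m ` {p. p permutes ?N} \<subseteq> {p. p permutes S}"
      using map_permutation_permutes[OF b] by blast
    show "map_permutation S (inv_into ?N b) ` {p. p permutes S} \<subseteq> {p. p permutes ?N}"
      using map_permutation_permutes[OF bij_betw_inv_into[OF b]] by blast
  qed
  have "fdet S A = (\<Sum>p | p permutes ?N. of_int (sign (?m p)) * (\<Prod>i\<in>S. A i (?m p i)))"
    unfolding fdet_def by (rule sum.reindex_bij_betw[OF bij, symmetric])
  also have "\<dots> = (\<Sum>p | p permutes ?N. of_int (sign p) * (\<Prod>i\<in>?N. A (b i) (b (p i))))"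
  proof (rule sum.cong[OF refl])
    fix p assume "p \<in> {p. p permutes ?N}"
    then have p: "p permutes ?N" by simp
    have "(\<Prod>i\<in>S. A i (?m p i)) = (\<Prod>i\<in>?N. A (b i) (?m p (b i)))"
      by (rule prod.reindex_bij_betw[OF b, symmetric])
    also have "\<dots> = (\<Prod>i\<in>?N. A (b i) (b (p i)))"
      by (intro prod.cong refl) (simp add: map_permutation_apply[OF inj])
    finally show "of_int (sign (?m p)) * (\<Prod>i\<in>S. A i (?m p i)) =
        of_int (sign p) * (\<Prod>i\<in>?N. A (b i) (b (p i)))"
      by (simp add: sign_map_permutation[OF inj p])
  qed
  also have "\<dots> = det (mat n n (\<lambda>(i, j). A (b i) (b j)))"
    by (subst det_def'[of _ n])
       (auto intro!: sum.cong arg_cong2[of _ _ _ _ "(*)"] prod.cong simp: permutes_in_image)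
  finally show ?thesis .
qed

lemma finite_enumeration:
  assumes "finite S"
  obtains b where "bij_betw b {0..<card S} S"
  using ex_bij_betw_nat_finite[OF assms] by blast

lemma fdet_mult:
  assumes "finite S"
  shows "fdet S (\<lambda>i j. \<Sum>l\<in>S. A i l * B l j) = fdet S A * fdet S B"
proof -
  obtain b where b: "bij_betw b {0..<card S} S" using assms by (rule finite_enumeration)
  let ?n = "card S"
  let ?A = "mat ?n ?n (\<lambda>(i, j). A (b i) (b j))" and ?B = "mat ?n ?n (\<lambda>(i, j). B (b i) (b j))"
  have "mat ?n ?n (\<lambda>(i, j). \<Sum>l\<in>S. A (b i) l * B l (b j)) = ?A * ?B"
    by (rule eq_matI) (auto simp: scalar_prod_def sum.reindex_bij_betw[OF b, symmetric])
  then show ?thesis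
    unfolding fdet_eq_det[OF b] by (simp add: det_mult[of _ ?n])
qed

lemma fdet_transpose:
  assumes "finite S"
  shows "fdet S (\<lambda>i j. A j i) = fdet S A"
proof -
  obtain b where b: "bij_betw b {0..<card S} S" using assms by (rule finite_enumeration)
  let ?n = "card S"
  have "mat ?n ?n (\<lambda>(i, j). A (b j) (b i)) = transpose_mat (mat ?n ?n (\<lambda>(i, j). A (b i) (b j)))"
    by (rule eq_matI) auto
  then show ?thesis unfolding fdet_eq_det[OF b] by (simp add: det_transpose[of _ ?n])
qed

lemma fdet_kernel_eq_0:
  fixes A :: "'i \<Rightarrow> 'i \<Rightarrow> 'a::field"
  assumes "finite S" and ker: "\<And>i. i \<in> S \<Longrightarrow> (\<Sum>j\<in>S. A i j * v j) = 0"
    and "s \<in> S" "v s \<noteq> 0"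
  shows "fdet S A = 0"
proof -
  obtain b where b: "bij_betw b {0..<card S} S" using assms(1) by (rule finite_enumeration)
  let ?n = "card S"
  let ?A = "mat ?n ?n (\<lambda>(i, j). A (b i) (b j))" and ?v = "vec ?n (\<lambda>i. v (b i))"
  obtain t where t: "t < ?n" "b t = s"
    using b \<open>s \<in> S\<close> unfolding bij_betw_def by (metis atLeastLessThan_iff imageE)
  have "?v \<noteq> 0\<^sub>v ?n"
    using t \<open>v s \<noteq> 0\<close> by (metis index_vec index_zero_vec(1))
  moreover have "?A *\<^sub>v ?v = 0\<^sub>v ?n"
  proof (rule eq_vecI)
    fix i assume "i < dim_vec (0\<^sub>v ?n :: 'a vec)"
    then have i: "i < ?n" by simp
    then have "b i \<in> S" using b by (auto simp: bij_betw_def)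
    have "(?A *\<^sub>v ?v) $ i = (\<Sum>j\<in>{0..<?n}. A (b i) (b j) * v (b j))"
      using i by (simp add: scalar_prod_def)
    also have "\<dots> = (\<Sum>j\<in>S. A (b i) j * v j)" by (rule sum.reindex_bij_betw[OF b])
    finally show "(?A *\<^sub>v ?v) $ i = 0\<^sub>v ?n $ i" using ker[OF \<open>b i \<in> S\<close>] i by simp
  qed simp
  ultimately show ?thesis
    unfolding fdet_eq_det[OF b] by (subst det_0_iff_vec_prod_zero_field[of _ ?n]) (auto intro!: exI[of _ ?v])
qed

text \<open>The rank \<open>h\<close> stands in for a linear order of \<open>S\<close>: off the
  diagonal, a nonzero entry leads to a column of smaller rank. Only the identity permutation then
  contributes.\<close>

lemma fdet_triangular:
  fixes h :: "'i \<Rightarrow> nat"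
  assumes "finite S"
    and tri: "\<And>i j. i \<in> S \<Longrightarrow> j \<in> S \<Longrightarrow> i \<noteq> j \<Longrightarrow> A i j \<noteq> 0 \<Longrightarrow> h j < h i"
  shows "fdet S A = (\<Prod>i\<in>S. A i i)"
proof -
  have "(\<Prod>i\<in>S. A i (p i)) = 0" if p: "p permutes S" and "p \<noteq> id" for p
  proof (rule ccontr)
    assume "(\<Prod>i\<in>S. A i (p i)) \<noteq> 0"
    then have nz: "A i (p i) \<noteq> 0" if "i \<in> S" for i
      using that assms(1) prod_zero by metis
    obtain a where "p a \<noteq> a" using \<open>p \<noteq> id\<close> by (metis eq_id_iff)
    \<comment> \<open>A moved point of least rank is contradictory: its image is moved as well, and
      the nonzero entry there gives it a smaller rank.\<close>
    then obtain i where i: "p i \<noteq> i" and min: "\<And>j. p j \<noteq> j \<Longrightarrow> h i \<le> h j"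
      using ex_has_least_nat[of "\<lambda>i. p i \<noteq> i" a h] by blast
    have "i \<in> S" using i p by (meson permutes_not_in)
    moreover have "p (p i) \<noteq> p i" using i permutes_inj[OF p] by (metis injD)
    ultimately show False
      using tri[of i "p i"] nz[of i] i min[of "p i"] permutes_in_image[OF p, of i] by force
  qed
  then have "fdet S A = (\<Sum>p\<in>{id}. of_int (sign p) * (\<Prod>i\<in>S. A i (p i)))"
    unfolding fdet_def
    by (intro sum.mono_neutral_right) (auto simp: assms(1) finite_permutations permutes_id)
  then show ?thesis by simp
qed

text \<open>Multiplying out each product, \<open>T\<close> collects the rows that contribute an
  entry of \<open>A\<close>. The other rows contribute diagonal entries, so the permutation fixes
  \<open>S - T\<close> and is a permutation of \<open>T\<close>; summing over these gives a
  principal minor.\<close>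

lemma fdet_add_diag:
  assumes "finite S"
  shows "fdet S (\<lambda>i j. (if i = j then d i else 0) + A i j) =
    (\<Sum>T\<in>Pow S. fdet T A * (\<Prod>i\<in>S - T. d i))"
proof -
  let ?s = "\<lambda>p. of_int (sign p) :: 'b"
  have "fdet S (\<lambda>i j. (if i = j then d i else 0) + A i j) =
    (\<Sum>p | p permutes S. \<Sum>T\<in>Pow S.
        ?s p * ((\<Prod>i\<in>T. A i (p i)) * (\<Prod>i\<in>S - T. if i = p i then d i else 0)))"
    unfolding fdet_def
    \<comment> \<open>With \<open>A\<close> as first summand, the subset produced by
      \<open>prod_add\<close> is the set of rows taken from \<open>A\<close>.\<close>
    by (subst add.commute) (simp add: prod_add[OF assms] sum_distrib_left)
  also have "\<dots> = (\<Sum>T\<in>Pow S. \<Sum>p | p permutes S.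
        ?s p * ((\<Prod>i\<in>T. A i (p i)) * (\<Prod>i\<in>S - T. if i = p i then d i else 0)))"
    by (rule sum.swap)
  also have "\<dots> = (\<Sum>T\<in>Pow S. fdet T A * (\<Prod>i\<in>S - T. d i))"
  proof (rule sum.cong[OF refl])
    fix T assume "T \<in> Pow S"
    then have T: "T \<subseteq> S" by simp
    have perm: "p permutes T" if "p permutes S" "\<forall>i\<in>S - T. i = p i" for p
      using permutes_superset[OF that(1), of T] that(2) by metis
    have "(\<Sum>p | p permutes S.
        ?s p * ((\<Prod>i\<in>T. A i (p i)) * (\<Prod>i\<in>S - T. if i = p i then d i else 0))) =
      (\<Sum>p | p permutes T.
        ?s p * ((\<Prod>i\<in>T. A i (p i)) * (\<Prod>i\<in>S - T. if i = p i then d i else 0)))"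
    proof (rule sum.mono_neutral_right)
      show "finite {p. p permutes S}" by (rule finite_permutations[OF assms])
      show "{p. p permutes T} \<subseteq> {p. p permutes S}" using T permutes_subset by blast
      show "\<forall>p\<in>{p. p permutes S} - {p. p permutes T}.
        ?s p * ((\<Prod>i\<in>T. A i (p i)) * (\<Prod>i\<in>S - T. if i = p i then d i else 0)) = 0"
      proof
        fix p assume "p \<in> {p. p permutes S} - {p. p permutes T}"
        then obtain i where "i \<in> S - T" "i \<noteq> p i" using perm by blast
        then have "(\<Prod>i\<in>S - T. if i = p i then d i else 0) = 0"
          using assms by (intro prod_zero) auto
        then show "?s p * ((\<Prod>i\<in>T. A i (p i)) * (\<Prod>i\<in>S - T. if i = p i then d i else 0)) = 0"
          by simp
      qed
    qed
    also have "\<dots> = (\<Sum>p | p permutes T. ?s p * ((\<Prod>i\<in>T. A i (p i)) * (\<Prod>i\<in>S - T. d i)))"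
      by (intro sum.cong refl arg_cong2[of _ _ _ _ "(*)"] prod.cong) (auto simp: permutes_not_in)
    finally show "(\<Sum>p | p permutes S.
        ?s p * ((\<Prod>i\<in>T. A i (p i)) * (\<Prod>i\<in>S - T. if i = p i then d i else 0))) =
      fdet T A * (\<Prod>i\<in>S - T. d i)"
      by (simp add: fdet_def sum_distrib_right mult.assoc)
  qed
  finally show ?thesis .
qed

text \<open>A permutation that moves \<open>r\<close> picks a zero entry of row \<open>r\<close>;
  the remaining ones are the permutations of \<open>S - {r}\<close>.\<close>

lemma fdet_expand_row:
  assumes "finite S" "r \<in> S" and zero: "\<And>j. j \<in> S \<Longrightarrow> j \<noteq> r \<Longrightarrow> A r j = 0"
  shows "fdet S A = A r r * fdet (S - {r}) A"
proof -
  have "fdet S A = (\<Sum>p | p permutes (S - {r}). of_int (sign p) * (\<Prod>i\<in>S. A i (p i)))"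
    unfolding fdet_def
  proof (rule sum.mono_neutral_right)
    show "finite {p. p permutes S}" by (rule finite_permutations[OF assms(1)])
    show "{p. p permutes (S - {r})} \<subseteq> {p. p permutes S}"
      using permutes_subset[of _ "S - {r}" S] by blast
    show "\<forall>p\<in>{p. p permutes S} - {p. p permutes (S - {r})}.
      of_int (sign p) * (\<Prod>i\<in>S. A i (p i)) = 0"
    proof
      fix p assume p: "p \<in> {p. p permutes S} - {p. p permutes (S - {r})}"
      then have "p r \<noteq> r"
        using permutes_superset[of p S "S - {r}"] by auto
      moreover have "p r \<in> S" using p assms(2) by (auto simp: permutes_in_image)
      ultimately have "(\<Prod>i\<in>S. A i (p i)) = 0"
        using assms(1,2) zero by (intro prod_zero) auto
      then show "of_int (sign p) * (\<Prod>i\<in>S. A i (p i)) = 0" by simp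
    qed
  qed
  also have "\<dots> = (\<Sum>p | p permutes (S - {r}).
      A r r * (of_int (sign p) * (\<Prod>i\<in>S - {r}. A i (p i))))"
    using assms(1,2) by (intro sum.cong refl) (auto simp: prod.remove permutes_not_in)
  finally show ?thesis by (simp add: fdet_def sum_distrib_left)
qed

text \<open>Sylvester's identity. Both \<open>?Q * ?P\<close> and \<open>?P * ?Q\<close> are block
  triangular, with determinants equal to the two sides, and \<open>det ?P = 1\<close> makes both
  equal to \<open>det ?Q\<close>.\<close>

lemma det_one_add_mult_commute:
  fixes A B :: "'a::idom mat"
  assumes A: "A \<in> carrier_mat n k" and B: "B \<in> carrier_mat k n"
  shows "det (1\<^sub>m n + A * B) = det (1\<^sub>m k + B * A)"
proof -
  let ?Q = "four_block_mat (1\<^sub>m n) A (- B) (1\<^sub>m k)"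
  let ?P = "four_block_mat (1\<^sub>m n) (0\<^sub>m n k) B (1\<^sub>m k)"
  have Q: "?Q \<in> carrier_mat (n + k) (n + k)" and P: "?P \<in> carrier_mat (n + k) (n + k)"
    using A B by auto
  have dP: "det ?P = 1"
    using B by (subst det_four_block_mat_upper_right_zero[of _ n _ k]) auto
  have "?Q * ?P = four_block_mat (1\<^sub>m n + A * B) A (0\<^sub>m k n) (1\<^sub>m k)"
    using A B by (subst mult_four_block_mat[of _ n n _ k _ k]) (auto intro!: cong_four_block_mat)
  then have 1: "det ?Q = det (1\<^sub>m n + A * B)"
    using det_mult[OF Q P] dP A B by (simp add: det_four_block_mat_lower_left_zero[of _ n _ k])
  have "?P * ?Q = four_block_mat (1\<^sub>m n) A (0\<^sub>m k n) (1\<^sub>m k + B * A)"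
    using A B by (subst mult_four_block_mat[of _ n n _ k _ k])
      (auto intro!: cong_four_block_mat simp: comm_add_mat[of _ k k])
  then have 2: "det ?Q = det (1\<^sub>m k + B * A)"
    using det_mult[OF P Q] dP A B by (simp add: det_four_block_mat_lower_left_zero[of _ n _ k])
  show ?thesis using 1 2 by simp
qed

text \<open>\<open>submatrix\<close> renumbers \<open>S\<close> through \<open>pick S\<close>, its
  increasing enumeration, which serves as the bijection in \<open>fdet_eq_det\<close>.\<close>

lemma det_submatrix_eq_fdet:
  assumes A: "A \<in> carrier_mat k k" and S: "S \<subseteq> {0..<k}"
  shows "det (submatrix A S S) = fdet S (\<lambda>i j. A $$ (i, j))"
proof -
  have fin: "finite S" using S finite_subset by blast
  have eq: "{i. i < k \<and> i \<in> S} = S" using S by auto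
  have "bij_betw (pick S) {0..<card S} S"
  proof -
    have "strict_mono_on {0..<card S} (pick S)"
      by (auto intro!: strict_mono_onI pick_mono_le)
    then have inj: "inj_on (pick S) {0..<card S}" by (rule strict_mono_on_imp_inj_on)
    have "pick S ` {0..<card S} \<subseteq> S" using pick_in_set_le by auto
    with inj fin have "pick S ` {0..<card S} = S"
      by (metis card_atLeastLessThan card_image card_subset_eq diff_zero)
    with inj show ?thesis by (simp add: bij_betw_def)
  qed
  then show ?thesis
    using A by (simp add: fdet_eq_det submatrix_def eq)
qed

lemma fdet_scale_rows: "fdet S (\<lambda>i j. c i * A i j) = (\<Prod>i\<in>S. c i) * fdet S A"
  by (simp add: fdet_def prod.distrib sum_distrib_left mult.left_commute)

lemma fdet_one_add_mult_commute:
  fixes X :: "'i \<Rightarrow> 'j \<Rightarrow> 'a::idom"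
  assumes "finite S" "finite T"
  shows "fdet S (\<lambda>i j. (if i = j then 1 else 0) + (\<Sum>l\<in>T. X i l * Y l j)) =
    fdet T (\<lambda>i j. (if i = j then 1 else 0) + (\<Sum>l\<in>S. Y i l * X l j))"
proof -
  obtain b where b: "bij_betw b {0..<card S} S" using assms(1) by (rule finite_enumeration)
  obtain c where c: "bij_betw c {0..<card T} T" using assms(2) by (rule finite_enumeration)
  have b_eq: "b i = b j \<longleftrightarrow> i = j" if "i < card S" "j < card S" for i j
    using b that by (auto simp: bij_betw_def inj_on_def)
  have c_eq: "c i = c j \<longleftrightarrow> i = j" if "i < card T" "j < card T" for i j
    using c that by (auto simp: bij_betw_def inj_on_def)
  let ?X = "mat (card S) (card T) (\<lambda>(i, j). X (b i) (c j))"
  let ?Y = "mat (card T) (card S) (\<lambda>(i, j). Y (c i) (b j))"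
  have "mat (card S) (card S) (\<lambda>(i, j). (if b i = b j then 1 else 0) + (\<Sum>l\<in>T. X (b i) l * Y l (b j)))
    = 1\<^sub>m (card S) + ?X * ?Y"
    by (rule eq_matI) (auto simp: scalar_prod_def b_eq sum.reindex_bij_betw[OF c, symmetric])
  moreover have "mat (card T) (card T) (\<lambda>(i, j). (if c i = c j then 1 else 0) + (\<Sum>l\<in>S. Y (c i) l * X l (c j)))
    = 1\<^sub>m (card T) + ?Y * ?X"
    by (rule eq_matI) (auto simp: scalar_prod_def c_eq sum.reindex_bij_betw[OF b, symmetric])
  ultimately show ?thesis
    unfolding fdet_eq_det[OF b] fdet_eq_det[OF c]
    by (simp add: det_one_add_mult_commute[of ?X "card S" "card T" ?Y])
qed

text \<open>Multilinearity in all rows at once: a product of sums is a sum over the choice functions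
  \<open>f\<close>, one summand chosen per row.\<close>

lemma fdet_sum_rows:
  assumes "finite S" "\<And>i. i \<in> S \<Longrightarrow> finite (N i)"
  shows "fdet S (\<lambda>i j. \<Sum>u\<in>N i. X i u j) = (\<Sum>f\<in>PiE S N. fdet S (\<lambda>i. X i (f i)))"
proof -
  have "fdet S (\<lambda>i j. \<Sum>u\<in>N i. X i u j) =
    (\<Sum>p | p permutes S. \<Sum>f\<in>PiE S N. of_int (sign p) * (\<Prod>i\<in>S. X i (f i) (p i)))"
    unfolding fdet_def using assms by (simp add: prod_sum_PiE sum_distrib_left)
  also have "\<dots> = (\<Sum>f\<in>PiE S N. fdet S (\<lambda>i. X i (f i)))"
    unfolding fdet_def by (rule sum.swap)
  finally show ?thesis .
qed

text \<open>Row and column operations of determinant 1 reduce \<open>L + J\<close> to a matrix whose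
  row \<open>r\<close> has the single nonzero entry \<open>n^2\<close>, and which agrees with
  \<open>L\<close> outside row and column \<open>r\<close>.\<close>

lemma fdet_add_ones:
  fixes L :: "'i \<Rightarrow> 'i \<Rightarrow> real"
  assumes fin: "finite V" and r: "r \<in> V"
    and row: "\<And>i. i \<in> V \<Longrightarrow> (\<Sum>j\<in>V. L i j) = 0"
    and col: "\<And>j. j \<in> V \<Longrightarrow> (\<Sum>i\<in>V. L i j) = 0"
  shows "fdet V (\<lambda>i j. L i j + 1) = real (card V) ^ 2 * fdet (V - {r}) L"
proof -
  define n where "n = real (card V)"
  have n: "n \<noteq> 0" using fin r by (auto simp: n_def)
  \<comment> \<open>Multiplying by \<open>U\<close> on the left replaces row \<open>r\<close> by the
    sum of all rows; its transpose on the right does the same with columns.\<close>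
  define U :: "'i \<Rightarrow> 'i \<Rightarrow> real" where "U = (\<lambda>i j. if i = r \<or> i = j then 1 else 0)"
  \<comment> \<open>Multiplying by \<open>Z\<close> on the right subtracts \<open>1 / n\<close>
    times column \<open>r\<close> from every other column.\<close>
  define Z :: "'i \<Rightarrow> 'i \<Rightarrow> real" where
    "Z = (\<lambda>i j. if i = j then 1 else if i = r then - 1 / n else 0)"
  define K1 where "K1 = (\<lambda>i j. \<Sum>l\<in>V. U i l * (L l j + 1))"
  define K2 where "K2 = (\<lambda>i j. \<Sum>l\<in>V. K1 i l * U j l)"
  define K3 where "K3 = (\<lambda>i j. \<Sum>l\<in>V. K2 i l * Z l j)"
  have dU: "fdet V U = 1"
    by (subst fdet_triangular[OF fin, of _ "\<lambda>i. if i = r then 1 else 0"]) (auto simp: U_def split: if_splits)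
  have dZ: "fdet V Z = 1"
    by (subst fdet_triangular[OF fin, of _ "\<lambda>i. if i = r then 1 else 0"]) (auto simp: Z_def split: if_splits)
  have "fdet V K3 = fdet V K2" unfolding K3_def by (simp add: fdet_mult[OF fin] dZ)
  also have "\<dots> = fdet V K1"
    unfolding K2_def using fdet_mult[OF fin, of K1 "\<lambda>l j. U j l"]
      fdet_transpose[OF fin, of U] dU by simp
  also have "\<dots> = fdet V (\<lambda>i j. L i j + 1)" unfolding K1_def by (simp add: fdet_mult[OF fin] dU)
  finally have K3: "fdet V (\<lambda>i j. L i j + 1) = fdet V K3" ..
  have Usum: "(\<Sum>l\<in>V. U i l * y l) = (if i = r then \<Sum>l\<in>V. y l else y i)" if "i \<in> V" for i y
  proof (cases "i = r")
    case False
    then have "(\<Sum>l\<in>V. U i l * y l) = (\<Sum>l\<in>V. if i = l then y l else 0)"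
      by (intro sum.cong) (auto simp: U_def)
    then show ?thesis using False that fin by simp
  qed (simp add: U_def)
  have Zsum: "(\<Sum>l\<in>V. y l * Z l j) = (if j = r then y r else y j - y r / n)" if "j \<in> V" for j y
  proof -
    have "(\<Sum>l\<in>V. y l * Z l j) =
      (\<Sum>l\<in>V. (if l = j then y l else 0) + (if l = r then (if j = r then 0 else - y r / n) else 0))"
      by (intro sum.cong) (auto simp: Z_def)
    then show ?thesis using that fin r by (simp add: sum.distrib)
  qed
  have K1: "K1 i j = (if i = r then n else L i j + 1)" if "i \<in> V" "j \<in> V" for i j
    unfolding K1_def Usum[OF that(1)] using col[OF that(2)] by (simp add: sum.distrib n_def)
  have K2: "K2 i j = (if j = r then if i = r then n * n else n else if i = r then n else L i j + 1)"
    if "i \<in> V" "j \<in> V" for i j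
  proof -
    have "K2 i j = (\<Sum>l\<in>V. U j l * K1 i l)" by (simp add: K2_def mult.commute)
    also have "\<dots> = (if j = r then \<Sum>l\<in>V. K1 i l else K1 i j)" by (rule Usum[OF that(2)])
    also have "(\<Sum>l\<in>V. K1 i l) = (\<Sum>l\<in>V. if i = r then n else L i l + 1)"
      using that(1) by (intro sum.cong) (auto simp: K1)
    also have "\<dots> = (if i = r then n * n else n)"
      using row[OF that(1)] by (simp add: sum.distrib n_def)
    finally show ?thesis using that by (simp add: K1)
  qed
  have K3': "K3 i j = (if j = r then K2 i r else K2 i j - K2 i r / n)" if "j \<in> V" for i j
    unfolding K3_def by (rule Zsum[OF that])
  \<comment> \<open>Off the corner, row and column \<open>r\<close> of \<open>K2\<close> are
    constantly \<open>n\<close>. Thus \<open>n - n * n / n = 0\<close> clears row \<open>r\<close>,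
    and \<open>n / n = 1\<close> removes the added ones elsewhere.\<close>
  have "fdet V K3 = K3 r r * fdet (V - {r}) K3"
    using n r by (intro fdet_expand_row[OF fin r]) (simp add: K3' K2)
  also have "K3 r r = n ^ 2" using r by (simp add: K3' K2 power2_eq_square)
  also have "fdet (V - {r}) K3 = fdet (V - {r}) L"
    using n r by (intro fdet_cong) (simp add: K3' K2)
  finally show ?thesis using K3 by (simp add: n_def)
qed

section \<open>Spanning trees as parent maps\<close>

text \<open>Take for \<open>h v\<close> the length of a shortest \<open>R\<close>-path from
  \<open>v\<close> to \<open>r\<close>; the first step of such a path lowers it.\<close>

lemma rtranclp_descent:
  "\<exists>h::'a \<Rightarrow> nat. \<forall>v. R\<^sup>*\<^sup>* v r \<longrightarrow> v \<noteq> r \<longrightarrow> (\<exists>u. R v u \<and> h u < h v)"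
proof -
  define h where "h v = (LEAST n. (R ^^ n) v r)" for v
  have "\<exists>u. R v u \<and> h u < h v" if v: "R\<^sup>*\<^sup>* v r" "v \<noteq> r" for v
  proof -
    have "(R ^^ h v) v r"
      unfolding h_def using v(1) by (metis LeastI rtranclp_imp_relpowp)
    with v(2) obtain n where n: "h v = Suc n" "(R ^^ Suc n) v r"
      by (cases "h v") auto
    then obtain u where u: "R v u" "(R ^^ n) u r" by (metis relpowp_Suc_D2)
    have "h u \<le> n" unfolding h_def using u(2) by (rule Least_le)
    with u n show ?thesis by auto
  qed
  then show ?thesis by blast
qed

text \<open>The path is extended backwards. If the new start already occurs on it, the part before
  that occurrence is dropped.\<close>

lemma rtranclp_imp_simple_path:
  assumes "R\<^sup>*\<^sup>* a b"
  shows "\<exists>cs. cs \<noteq> [] \<and> hd cs = a \<and> last cs = b \<and> distinct cs \<and> successively R cs"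
  using assms
proof (induction rule: converse_rtranclp_induct)
  case base
  show ?case by (rule exI[of _ "[b]"]) simp
next
  case (step a c)
  then obtain cs where cs: "cs \<noteq> []" "hd cs = c" "last cs = b" "distinct cs" "successively R cs"
    by blast
  show ?case
  proof (cases "a \<in> set cs")
    case True
    then obtain ys zs where "cs = ys @ a # zs" by (meson split_list)
    with cs show ?thesis
      by (intro exI[of _ "a # zs"]) (auto simp: successively_append_iff)
  next
    case False
    with cs step.hyps(1) show ?thesis
      by (intro exI[of _ "a # cs"]) (auto simp: successively_Cons)
  qed
qed

definition parent_edges :: "'a set \<Rightarrow> 'a \<Rightarrow> ('a \<Rightarrow> 'a) \<Rightarrow> 'a set set" where
  "parent_edges V r f = (\<lambda>v. {v, f v}) ` (V - {r})"

text \<open>The strictly decreasing rank \<open>h\<close> says that iterating \<open>f\<close> leads every vertex to the root.\<close>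

definition parent_maps :: "'a set \<Rightarrow> 'a \<Rightarrow> ('a \<Rightarrow> 'a \<Rightarrow> bool) \<Rightarrow> ('a \<Rightarrow> 'a) set" where
  "parent_maps V r adj = {f \<in> PiE (V - {r}) (\<lambda>v. {u \<in> V. adj v u}).
     \<exists>h::'a \<Rightarrow> nat. \<forall>v\<in>V - {r}. h (f v) < h v}"

text \<open>By induction on the rank, following parents leads from every vertex to \<open>r\<close>.
  Edges are unordered, so any two vertices are joined through \<open>r\<close>.\<close>

lemma parent_edges_connected:
  fixes h :: "'a \<Rightarrow> nat"
  assumes "r \<in> V" "\<And>v. v \<in> V - {r} \<Longrightarrow> f v \<in> V" "\<And>v. v \<in> V - {r} \<Longrightarrow> h (f v) < h v"
  shows "connected_graph V (\<lambda>u v. {u, v} \<in> parent_edges V r f)"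
proof -
  let ?R = "\<lambda>a b. a \<in> V \<and> b \<in> V \<and> {a, b} \<in> parent_edges V r f"
  have to_root: "?R\<^sup>*\<^sup>* v r" if "v \<in> V" for v
    using that
  proof (induction "h v" arbitrary: v rule: less_induct)
    case less
    show ?case
    proof (cases "v = r")
      case False
      then have "?R v (f v)" using less.prems assms(2) by (auto simp: parent_edges_def)
      moreover have "?R\<^sup>*\<^sup>* (f v) r" using False less assms(2,3) by blast
      ultimately show ?thesis by (rule converse_rtranclp_into_rtranclp)
    qed simp
  qed
  have "symp ?R" by (auto intro!: sympI simp: insert_commute)
  then have "symp ?R\<^sup>*\<^sup>*" by (rule symp_rtranclp)
  then have "?R\<^sup>*\<^sup>* u v" if "u \<in> V" "v \<in> V" for u v
    using to_root[OF that(1)] to_root[OF that(2)] by (meson rtranclp_trans sympD)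
  then show ?thesis unfolding connected_graph_def using assms(1) by blast
qed

text \<open>A vertex of maximal rank on a cycle would have its parent as both of its neighbours.\<close>

lemma parent_edges_acyclic:
  fixes h :: "'a \<Rightarrow> nat"
  assumes h: "\<And>v. v \<in> V - {r} \<Longrightarrow> h (f v) < h v"
  shows "\<not> has_cycle V (parent_edges V r f)"
proof
  assume "has_cycle V (parent_edges V r f)"
  then obtain cs where len: "length cs \<ge> 3" and dist: "distinct cs"
    and edge: "\<And>i. i < length cs \<Longrightarrow> {cs ! i, cs ! ((i + 1) mod length cs)} \<in> parent_edges V r f"
    unfolding has_cycle_def by blast
  let ?n = "length cs"
  \<comment> \<open>Every edge joins a vertex to its parent of smaller rank, so an endpoint of rank
    at least that of the other is the child.\<close>
  have parent: "u = f v" if "{v, u} \<in> parent_edges V r f" "h u \<le> h v" for u v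
    using that h by (fastforce simp: parent_edges_def doubleton_eq_iff)
  have "finite ((\<lambda>i. h (cs ! i)) ` {..<?n})" "(\<lambda>i. h (cs ! i)) ` {..<?n} \<noteq> {}"
    using len by (auto simp: lessThan_empty_iff)
  then have "Max ((\<lambda>i. h (cs ! i)) ` {..<?n}) \<in> (\<lambda>i. h (cs ! i)) ` {..<?n}"
    by (rule Max_in)
  then obtain i where i: "i < ?n" "h (cs ! i) = Max ((\<lambda>i. h (cs ! i)) ` {..<?n})" by auto
  have max: "h (cs ! j) \<le> h (cs ! i)" if "j < ?n" for j
    unfolding i(2) using that by (intro Max_ge) auto
  \<comment> \<open>\<open>j\<close> and \<open>l\<close> are the cyclic predecessor and successor
    of \<open>i\<close>; they differ because the cycle has length at least 3.\<close>
  define j where "j = (if i = 0 then ?n - 1 else i - 1)"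
  define l where "l = (if i + 1 = ?n then 0 else i + 1)"
  have jl: "j < ?n" "l < ?n" "j \<noteq> l" using i(1) len by (auto simp: j_def l_def)
  have "(j + 1) mod ?n = i" using i(1) len by (auto simp: j_def)
  with edge[OF jl(1)] have "{cs ! i, cs ! j} \<in> parent_edges V r f" by (simp add: insert_commute)
  moreover have "(i + 1) mod ?n = l" using i(1) by (auto simp: l_def)
  with edge[OF i(1)] have "{cs ! i, cs ! l} \<in> parent_edges V r f" by simp
  ultimately have "cs ! j = cs ! l" using parent max jl by metis
  with dist jl show False by (simp add: nth_eq_iff_index_eq)
qed

lemma spanning_tree_parent_edges:
  assumes "r \<in> V" "f \<in> parent_maps V r adj"
  shows "spanning_tree V adj (parent_edges V r f)"
proof -
  obtain h :: "'a \<Rightarrow> nat" where h: "\<And>v. v \<in> V - {r} \<Longrightarrow> h (f v) < h v"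
    using assms(2) unfolding parent_maps_def by blast
  have f: "f v \<in> V" "adj v (f v)" if "v \<in> V - {r}" for v
    using assms(2) that unfolding parent_maps_def by auto
  have "parent_edges V r f \<subseteq> graph_edges V adj"
    using f unfolding parent_edges_def graph_edges_def by blast
  then show ?thesis
    unfolding spanning_tree_def
    using parent_edges_connected[of r V f h] parent_edges_acyclic[of V r h f] assms(1) f h by blast
qed

text \<open>Induction on the rank for \<open>f\<close>. If \<open>{v, f v}\<close> were the
  \<open>g\<close>-edge of \<open>w = f v\<close>, then \<open>g w = v\<close>, and the induction
  hypothesis at \<open>w\<close> would give \<open>f w = v\<close>, so that \<open>v\<close> and
  \<open>w\<close> would each have smaller rank than the other.\<close>

lemma inj_on_parent_edges: "inj_on (parent_edges V r) (parent_maps V r adj)"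
proof (rule inj_onI)
  fix f g assume f: "f \<in> parent_maps V r adj" and g: "g \<in> parent_maps V r adj"
    and eq: "parent_edges V r f = parent_edges V r g"
  obtain h :: "'a \<Rightarrow> nat" where h: "\<And>v. v \<in> V - {r} \<Longrightarrow> h (f v) < h v"
    using f unfolding parent_maps_def by blast
  have "f v = g v" if "v \<in> V - {r}" for v
    using that
  proof (induction "h v" arbitrary: v rule: less_induct)
    case less
    have "{v, f v} \<in> parent_edges V r g"
      using less.prems eq unfolding parent_edges_def by blast
    then obtain w where w: "w \<in> V - {r}" "{v, f v} = {w, g w}"
      unfolding parent_edges_def by blast
    then consider "v = w" "f v = g w" | "f v = w" "v = g w" by (auto simp: doubleton_eq_iff)
    then show ?case
    proof cases
      case 2
      then have "f w = v" using less.hyps[of w] w(1) h[OF less.prems] by simp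
      with 2 h[OF less.prems] h[OF w(1)] show ?thesis by simp
    qed simp
  qed
  moreover have "f \<in> extensional (V - {r})" "g \<in> extensional (V - {r})"
    using f g by (auto simp: parent_maps_def PiE_def)
  ultimately show "f = g" by (intro extensionalityI)
qed

text \<open>The ends of an edge of \<open>T\<close> outside \<open>T'\<close> are joined by a simple
  path in \<open>T'\<close>, which that edge closes to a cycle in \<open>T\<close>.\<close>

lemma spanning_tree_connected_subset_eq:
  assumes "simple_graph V adj" and T: "spanning_tree V adj T"
    and "T' \<subseteq> T" and conn: "connected_graph V (\<lambda>u v. {u, v} \<in> T')"
  shows "T' = T"
proof (rule ccontr)
  assume "T' \<noteq> T"
  then obtain e where e: "e \<in> T" "e \<notin> T'" using assms(3) by blast
  then obtain a b where ab: "e = {a, b}" "a \<in> V" "b \<in> V" "adj a b"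
    using T unfolding spanning_tree_def graph_edges_def by blast
  have "a \<noteq> b" using ab assms(1) unfolding simple_graph_def by blast
  let ?R = "\<lambda>u v. u \<in> V \<and> v \<in> V \<and> {u, v} \<in> T'"
  have "?R\<^sup>*\<^sup>* a b" using conn ab unfolding connected_graph_def by blast
  from rtranclp_imp_simple_path[OF this] obtain cs where
    cs: "cs \<noteq> []" "hd cs = a" "last cs = b" "distinct cs" "successively ?R cs"
    by blast
  let ?n = "length cs"
  have succ: "?R (cs ! i) (cs ! Suc i)" if "Suc i < ?n" for i
    using successively_nth[OF cs(5) that] .
  have hd: "cs ! 0 = a" and last: "cs ! (?n - 1) = b"
    using cs by (simp_all add: hd_conv_nth last_conv_nth)
  \<comment> \<open>A cycle needs three vertices: a path of one vertex would give
    \<open>a = b\<close>, and a path of two would put \<open>e\<close> into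
    \<open>T'\<close>.\<close>
  have "?n \<noteq> 1" using hd last \<open>a \<noteq> b\<close> by auto
  moreover have "?n \<noteq> 2" using succ[of 0] hd last e ab by auto
  moreover have "?n \<noteq> 0" using cs(1) by simp
  ultimately have len: "?n \<ge> 3" by linarith
  have "cs ! i \<in> V" if "i < ?n" for i
    using that succ[of i] succ[of "i - 1"] len by (cases i) auto
  then have "set cs \<subseteq> V" by (auto simp: in_set_conv_nth)
  moreover have "{cs ! i, cs ! ((i + 1) mod ?n)} \<in> T" if "i < ?n" for i
  proof (cases "Suc i < ?n")
    case True
    then show ?thesis using succ[OF True] assms(3) by auto
  next
    \<comment> \<open>At the last index the successor wraps around to \<open>a\<close>, and the edge
      is the closing edge \<open>e\<close>.\<close>
    case False
    then have "Suc i = ?n" using that by simp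
    then have "(i + 1) mod ?n = 0" "cs ! i = b" using last by (simp_all flip: \<open>Suc i = ?n\<close>)
    then show ?thesis using hd e ab by (simp add: insert_commute)
  qed
  ultimately have "has_cycle V T"
    unfolding has_cycle_def using len cs(4) by blast
  with T show False unfolding spanning_tree_def by blast
qed

text \<open>The parent of \<open>v\<close> is a \<open>T\<close>-neighbour of smaller rank in the
  sense of \<open>rtranclp_descent\<close>. These edges already connect \<open>V\<close>, so they
  exhaust \<open>T\<close>.\<close>

lemma spanning_tree_imp_parent_map:
  assumes G: "simple_graph V adj" and r: "r \<in> V" and T: "spanning_tree V adj T"
  shows "\<exists>f\<in>parent_maps V r adj. parent_edges V r f = T"
proof -
  let ?R = "\<lambda>u v. u \<in> V \<and> v \<in> V \<and> {u, v} \<in> T"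
  obtain h :: "'a \<Rightarrow> nat" where
    h: "\<forall>v. ?R\<^sup>*\<^sup>* v r \<longrightarrow> v \<noteq> r \<longrightarrow> (\<exists>u. ?R v u \<and> h u < h v)"
    using rtranclp_descent[of ?R r] by blast
  have "\<exists>u. ?R v u \<and> h u < h v" if "v \<in> V - {r}" for v
    using that h T r unfolding spanning_tree_def connected_graph_def by blast
  then obtain g where g: "\<And>v. v \<in> V - {r} \<Longrightarrow> ?R v (g v) \<and> h (g v) < h v" by metis
  define f where "f = restrict g (V - {r})"
  have f: "?R v (f v)" "h (f v) < h v" if "v \<in> V - {r}" for v
    using g[OF that] that by (simp_all add: f_def)
  have adj: "adj v (f v)" if "v \<in> V - {r}" for v
  proof -
    have "{v, f v} \<in> graph_edges V adj"
      using f(1)[OF that] T unfolding spanning_tree_def by blast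
    then obtain a b where "{v, f v} = {a, b}" "a \<in> V" "b \<in> V" "adj a b"
      unfolding graph_edges_def by blast
    \<comment> \<open>The edge determines \<open>a\<close> and \<open>b\<close> only up to order;
      symmetry of \<open>adj\<close> covers both orders.\<close>
    then show ?thesis using G unfolding simple_graph_def by (metis doubleton_eq_iff)
  qed
  have "f \<in> PiE (V - {r}) (\<lambda>v. {u \<in> V. adj v u})"
  proof (rule PiE_I)
    show "f v \<in> {u \<in> V. adj v u}" if "v \<in> V - {r}" for v using f(1)[OF that] adj[OF that] by blast
  qed (simp only: f_def restrict_apply if_False)
  then have "f \<in> parent_maps V r adj"
    unfolding parent_maps_def using f(2) by blast
  moreover have "parent_edges V r f \<subseteq> T"
    using f unfolding parent_edges_def by blast
  then have "parent_edges V r f = T"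
    using parent_edges_connected[of r V f h] f r
    by (intro spanning_tree_connected_subset_eq[OF G T]) simp_all
  ultimately show ?thesis by blast
qed

lemma complexity_eq_card_parent_maps:
  assumes "simple_graph V adj" "r \<in> V"
  shows "complexity V adj = card (parent_maps V r adj)"
proof -
  have "{T. spanning_tree V adj T} = parent_edges V r ` parent_maps V r adj"
    using spanning_tree_parent_edges[OF assms(2)] spanning_tree_imp_parent_map[OF assms]
    by (auto simp: image_iff) metis
  then show ?thesis
    unfolding complexity_def by (simp add: card_image[OF inj_on_parent_edges])
qed

text \<open>If some vertex never reaches the root, the indicator of the set of all such vertices lies in
  the kernel.\<close>

lemma fdet_parent_map:
  fixes f :: "'a \<Rightarrow> 'a"
  assumes fin: "finite V" and f: "f \<in> (V - {r}) \<rightarrow> V"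
  shows "fdet (V - {r}) (\<lambda>i j. (if i = j then 1 else 0) - (if f i = j then 1 else 0)) =
    (if \<exists>h::'a \<Rightarrow> nat. \<forall>v\<in>V - {r}. h (f v) < h v then 1 else 0 :: real)"
proof (cases "\<exists>h::'a \<Rightarrow> nat. \<forall>v\<in>V - {r}. h (f v) < h v")
  case True
  then obtain h :: "'a \<Rightarrow> nat" where h: "\<And>v. v \<in> V - {r} \<Longrightarrow> h (f v) < h v" by blast
  \<comment> \<open>The matrix is triangular for the rank \<open>h\<close>, and its diagonal is 1
    because \<open>f\<close> has no fixed point.\<close>
  have ne: "f i \<noteq> i" if "i \<in> V - {r}" for i using h[OF that] by auto
  have "fdet (V - {r}) (\<lambda>i j. (if i = j then 1 else 0) - (if f i = j then 1 else 0)) =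
    (\<Prod>i\<in>V - {r}. (if i = i then 1 else 0) - (if f i = i then 1 else 0) :: real)"
    using fin h by (intro fdet_triangular[of _ _ h]) (auto split: if_splits)
  also have "\<dots> = 1"
    by (intro prod.neutral) (simp add: ne)
  finally show ?thesis using True by simp
next
  case False
  let ?R = "\<lambda>u v. u \<in> V - {r} \<and> v = f u"
  define c :: "'a \<Rightarrow> real" where "c v = (if ?R\<^sup>*\<^sup>* v r then 0 else 1)" for v
  have c_step: "c (f v) = c v" if "v \<in> V - {r}" for v
  proof -
    have "?R\<^sup>*\<^sup>* (f v) r \<longleftrightarrow> ?R\<^sup>*\<^sup>* v r"
    proof
      assume "?R\<^sup>*\<^sup>* (f v) r"
      then show "?R\<^sup>*\<^sup>* v r" using that by (intro converse_rtranclp_into_rtranclp[of ?R v "f v"]) auto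
    next
      assume "?R\<^sup>*\<^sup>* v r"
      then show "?R\<^sup>*\<^sup>* (f v) r" using that by (cases rule: converse_rtranclpE) auto
    qed
    then show ?thesis by (simp add: c_def)
  qed
  \<comment> \<open>If every vertex reached \<open>r\<close>, a descent function for
    \<open>?R\<close> would be a rank for \<open>f\<close>, since \<open>f v\<close> is the only
    \<open>?R\<close>-successor of \<open>v\<close>.\<close>
  have "\<exists>s\<in>V - {r}. c s \<noteq> 0"
  proof (rule ccontr)
    assume "\<not> (\<exists>s\<in>V - {r}. c s \<noteq> 0)"
    then have reach: "?R\<^sup>*\<^sup>* v r" if "v \<in> V - {r}" for v
      using that by (metis c_def zero_neq_one)
    obtain h :: "'a \<Rightarrow> nat" where
    h: "\<forall>v. ?R\<^sup>*\<^sup>* v r \<longrightarrow> v \<noteq> r \<longrightarrow> (\<exists>u. ?R v u \<and> h u < h v)"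
      using rtranclp_descent[of ?R r] by blast
    have "\<forall>v\<in>V - {r}. h (f v) < h v" using h reach by blast
    with False show False by blast
  qed
  then obtain s where s: "s \<in> V - {r}" "c s \<noteq> 0" by blast
  have "fdet (V - {r}) (\<lambda>i j. (if i = j then 1 else 0) - (if f i = j then 1 else 0)) = (0 :: real)"
  proof (rule fdet_kernel_eq_0[where s = s and v = c])
    show "finite (V - {r})" "s \<in> V - {r}" "c s \<noteq> 0" using fin s by simp_all
    fix i assume i: "i \<in> V - {r}"
    have "(\<Sum>j\<in>V - {r}. ((if i = j then 1 else 0) - (if f i = j then 1 else 0)) * c j) =
      (\<Sum>j\<in>V - {r}. (if i = j then c j else 0)) - (\<Sum>j\<in>V - {r}. (if f i = j then c j else 0))"
      unfolding sum_subtractf[symmetric] by (intro sum.cong) auto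
    also have "\<dots> = c i - c (f i)"
    \<comment> \<open>For \<open>f i = r\<close> the second sum vanishes, in agreement with
      \<open>c r = 0\<close>.\<close>
    proof -
      have "c r = 0" by (simp add: c_def)
      moreover have "f i \<in> V" using f i by blast
      ultimately show ?thesis using fin i by auto
    qed
    also have "\<dots> = 0" using c_step[OF i] by simp
    finally show "(\<Sum>j\<in>V - {r}. ((if i = j then 1 else 0) - (if f i = j then 1 else 0)) * c j) = 0" .
  qed
  then show ?thesis using False by simp
qed

section \<open>The matrix-tree theorem\<close>

definition laplacian :: "'a set \<Rightarrow> ('a \<Rightarrow> 'a \<Rightarrow> bool) \<Rightarrow> 'a \<Rightarrow> 'a \<Rightarrow> real" where
  "laplacian V adj i j =
     (if i = j then real (card {u \<in> V. adj i u}) else 0) - (if adj i j then 1 else 0)"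

text \<open>Each row of the reduced Laplacian is the sum of the rows \<open>e\<^sub>v - e\<^sub>u\<close> over the neighbours
  \<open>u\<close> of \<open>v\<close> (with \<open>e\<^sub>r = 0\<close>), so multilinearity expands the determinant over all maps that send
  every vertex other than the root to a neighbour.\<close>

theorem matrix_tree:
  assumes G: "simple_graph V adj" and r: "r \<in> V"
  shows "real (complexity V adj) = fdet (V - {r}) (laplacian V adj)"
proof -
  have fin: "finite V" using G by (simp add: simple_graph_def)
  let ?N = "\<lambda>i. {u \<in> V. adj i u}"
  let ?F = "PiE (V - {r}) ?N"
  have "fdet (V - {r}) (laplacian V adj) =
    fdet (V - {r}) (\<lambda>i j. \<Sum>u\<in>?N i. (if i = j then 1 else 0) - (if u = j then 1 else 0))"
  proof (rule fdet_cong)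
    fix i j assume "i \<in> V - {r}" "j \<in> V - {r}"
    then show "laplacian V adj i j =
      (\<Sum>u\<in>?N i. (if i = j then 1 else 0) - (if u = j then 1 else 0))"
      using fin by (simp add: laplacian_def sum_subtractf)
  qed
  also have "\<dots> = (\<Sum>f\<in>?F. fdet (V - {r}) (\<lambda>i j. (if i = j then 1 else 0) - (if f i = j then 1 else 0)))"
    using fin by (intro fdet_sum_rows) auto
  also have "\<dots> = (\<Sum>f\<in>?F. if \<exists>h::'a \<Rightarrow> nat. \<forall>v\<in>V - {r}. h (f v) < h v then 1 else 0)"
    using fin by (intro sum.cong refl fdet_parent_map) auto
  also have "\<dots> = real (card (parent_maps V r adj))"
    using fin by (simp add: parent_maps_def sum.If_cases finite_PiE Int_def conj_commute)
  finally show ?thesis by (simp add: complexity_eq_card_parent_maps[OF assms])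
qed

text \<open>Laplacian rows sum to zero because the diagonal holds the degrees, and columns do so by
  symmetry. Hence \<open>fdet_add_ones\<close> applies with any root, and the matrix-tree theorem
  evaluates the remaining minor.\<close>

lemma fdet_laplacian_add_ones:
  assumes G: "simple_graph V adj" and "V \<noteq> {}"
  shows "fdet V (\<lambda>i j. laplacian V adj i j + 1) = real (card V) ^ 2 * real (complexity V adj)"
proof -
  obtain r where r: "r \<in> V" using assms(2) by blast
  have fin: "finite V" using G by (simp add: simple_graph_def)
  have row: "(\<Sum>j\<in>V. laplacian V adj i j) = 0" if "i \<in> V" for i
    using fin that by (simp add: laplacian_def sum_subtractf sum.If_cases Int_def)
  have "laplacian V adj i j = laplacian V adj j i" if "i \<in> V" "j \<in> V" for i j
    using that G by (auto simp: laplacian_def simple_graph_def)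
  then have "(\<Sum>i\<in>V. laplacian V adj i j) = 0" if "j \<in> V" for j
    using row[OF that] that by simp
  then show ?thesis
    using fdet_add_ones[OF fin r row] matrix_tree[OF G r] by simp
qed

section \<open>Clique-replaced graphs\<close>

lemma cr_vertices_eq_Sigma: "cr_vertices k x = Sigma {..<k} (\<lambda>i. {..<x i})"
  by (auto simp: cr_vertices_def)

lemma simple_graph_cr:
  assumes "simple_graph {0..<k} E"
  shows "simple_graph (cr_vertices k x) (cr_adj E)"
  using assms by (auto simp: simple_graph_def cr_vertices_eq_Sigma cr_adj_def)

text \<open>The closed neighbourhood of \<open>p\<close> consists of its own clique and all adjacent
  cliques in full; \<open>Suc\<close> accounts for \<open>p\<close> itself. The right-hand side is
  the number \<open>m\<close> of its block.\<close>

lemma card_cr_neighbours: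
  assumes E: "simple_graph {0..<k} E" and p: "p \<in> cr_vertices k x"
  shows "Suc (card {q \<in> cr_vertices k x. cr_adj E p q}) =
    x (fst p) + (\<Sum>j\<in>{j. j < k \<and> E (fst p) j}. x j)"
proof -
  let ?N = "{q \<in> cr_vertices k x. cr_adj E p q}" and ?J = "{j. j < k \<and> E (fst p) j}"
  have fp: "fst p < k" using p by (auto simp: cr_vertices_def)
  then have irr: "\<not> E (fst p) (fst p)" using E by (auto simp: simple_graph_def)
  have "insert p ?N = Sigma (insert (fst p) ?J) (\<lambda>i. {..<x i})"
    using p irr by (auto simp: cr_vertices_eq_Sigma cr_adj_def)
  moreover have "finite ?N" by (simp add: cr_vertices_eq_Sigma)
  moreover have "p \<notin> ?N" by (auto simp: cr_adj_def)
  ultimately have "Suc (card ?N) = card (Sigma (insert (fst p) ?J) (\<lambda>i. {..<x i}))"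
    by (metis card_insert_disjoint)
  then show ?thesis using irr by simp
qed

theorem theorem4p1:
  fixes k :: nat and E :: "nat \<Rightarrow> nat \<Rightarrow> bool" and x :: "nat \<Rightarrow> nat"
    and m :: "nat \<Rightarrow> nat" and lam :: "nat \<Rightarrow> real" and \<Psi> :: real and n :: nat
  assumes "simple_graph {0..<k} E"
    and "connected_graph {0..<k} E"
    and "\<forall>i<k. x i > 0"
    and "\<forall>i<k. m i = x i + (\<Sum>j\<in>{j. j < k \<and> E i j}. x j)"
    and "\<forall>i<k. lam i = real (m i) / real (x i)"
    and "\<Psi> = (\<Prod>i<k. lam i)"
    and "n = (\<Sum>i<k. x i)"
  shows "real (complexity (cr_vertices k x) (cr_adj E)) =
    (\<Prod>i<k. real (m i) ^ x i) / (\<Psi> * real n ^ 2) *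
    (\<Psi> + (\<Sum>S\<in>{S. S \<subseteq> {0..<k} \<and> S \<noteq> {}}.
        det (submatrix (compl_adj_mat k E) S S) * (\<Prod>i\<in>{0..<k} - S. lam i)))"
proof -
  define V where "V = cr_vertices k x"
  define A :: "nat \<Rightarrow> nat \<Rightarrow> real" where "A i j = (if i \<noteq> j \<and> \<not> E i j then 1 else 0)" for i j
  let ?K = "{0..<k}"
  have x: "x i > 0" and m: "m i = x i + (\<Sum>j\<in>{j. j < k \<and> E i j}. x j)"
    and lam: "lam i = real (m i) / real (x i)" if "i < k" for i
    using assms(3-5) that by auto
  have m_pos: "m i > 0" if "i < k" for i using x[OF that] m[OF that] by simp
  have lam_pos: "lam i > 0" if "i < k" for i using x m_pos lam that by simp
  have "\<Psi> \<noteq> 0" using lam_pos by (simp add: assms(6) less_imp_neq[symmetric])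
  have k: "k > 0" using assms(2) by (auto simp: connected_graph_def)
  have finV: "finite V" by (simp add: V_def cr_vertices_eq_Sigma)
  have card_V: "card V = n" by (simp add: V_def cr_vertices_eq_Sigma assms(7))
  have fst_V: "fst p < k" if "p \<in> V" for p using that by (auto simp: V_def cr_vertices_def)
  have "(0, 0) \<in> V" using k x by (simp add: V_def cr_vertices_def)
  then have "V \<noteq> {}" by blast
  then have "n \<noteq> 0" using card_V finV by auto
  have sg: "simple_graph V (cr_adj E)" unfolding V_def by (rule simple_graph_cr[OF assms(1)])
  have "real n ^ 2 * real (complexity V (cr_adj E)) = fdet V (\<lambda>p q. laplacian V (cr_adj E) p q + 1)"
    using fdet_laplacian_add_ones[OF sg \<open>V \<noteq> {}\<close>] by (simp add: card_V)
  \<comment> \<open>Row \<open>p\<close> is divided by its \<open>m\<close>, and the complement part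
    is written as a product through the \<open>k\<close> blocks, the second factor being the block
    incidence matrix.\<close>
  also have "\<dots> = fdet V (\<lambda>p q. real (m (fst p)) * ((if p = q then 1 else 0) +
      (\<Sum>i\<in>?K. (A (fst p) i / real (m (fst p))) * (if fst q = i then 1 else 0))))"
  proof (rule fdet_cong)
    fix p q assume pq: "p \<in> V" "q \<in> V"
    have "real (card {u \<in> V. cr_adj E p u}) + 1 = real (m (fst p))"
      using card_cr_neighbours[OF assms(1), of p x] pq(1) m[OF fst_V[OF pq(1)]]
      unfolding V_def by linarith
    \<comment> \<open>The added 1 cancels the -1 of adjacent pairs and completes the degree to
      \<open>m\<close> on the diagonal; pairs inside one clique are covered by
      \<open>A i i = 0\<close>.\<close>
    then have "laplacian V (cr_adj E) p q + 1 = (if p = q then real (m (fst p)) else 0) + A (fst p) (fst q)"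
      by (cases p; cases q) (auto simp: laplacian_def cr_adj_def A_def)
    moreover have "(\<Sum>i\<in>?K. (A (fst p) i / real (m (fst p))) * (if fst q = i then 1 else 0)) =
      A (fst p) (fst q) / real (m (fst p))"
      using fst_V[OF pq(2)] by (simp add: if_distrib[of "\<lambda>t. _ * t"] cong: if_cong)
    ultimately show "laplacian V (cr_adj E) p q + 1 = real (m (fst p)) * ((if p = q then 1 else 0) +
      (\<Sum>i\<in>?K. (A (fst p) i / real (m (fst p))) * (if fst q = i then 1 else 0)))"
      using m_pos[OF fst_V[OF pq(1)]] by (simp add: distrib_left)
  qed
  \<comment> \<open>Sylvester's identity passes from an index set of size \<open>n\<close> to one of
    size \<open>k\<close>.\<close>
  also have "\<dots> = (\<Prod>p\<in>V. real (m (fst p))) * fdet ?K (\<lambda>i j. (if i = j then 1 else 0) +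
      (\<Sum>p\<in>V. (if fst p = i then 1 else 0) * (A (fst p) j / real (m (fst p)))))"
    unfolding fdet_scale_rows
    by (subst fdet_one_add_mult_commute[OF finV]) auto
  also have "(\<Prod>p\<in>V. real (m (fst p))) = (\<Prod>i<k. real (m i) ^ x i)"
    unfolding V_def cr_vertices_eq_Sigma
    using prod.Sigma[of "{..<k}" "\<lambda>i. {..<x i}" "\<lambda>i a. real (m i)"] by (simp add: case_prod_unfold)
  also have "fdet ?K (\<lambda>i j. (if i = j then 1 else 0) +
      (\<Sum>p\<in>V. (if fst p = i then 1 else 0) * (A (fst p) j / real (m (fst p))))) =
    fdet ?K (\<lambda>i j. (1 / lam i) * ((if i = j then lam i else 0) + A i j))"
  proof (rule fdet_cong)
    fix i j assume "i \<in> ?K" "j \<in> ?K"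
    then have i: "i < k" by simp
    have "(\<Sum>p\<in>V. (if fst p = i then 1 else 0) * (A (fst p) j / real (m (fst p)))) =
      (\<Sum>l<k. \<Sum>a<x l. (if l = i then 1 else 0) * (A l j / real (m l)))"
      unfolding V_def cr_vertices_eq_Sigma by (subst sum.Sigma) (auto simp: case_prod_unfold)
    \<comment> \<open>The \<open>x l\<close> copies in a block contribute equally, which produces
      the factor \<open>x i / m i = 1 / lam i\<close>.\<close>
    also have "\<dots> = (\<Sum>l<k. if l = i then real (x l) * (A l j / real (m l)) else 0)"
      by (intro sum.cong) auto
    also have "\<dots> = A i j / lam i" using i x[OF i] lam[OF i] by simp
    finally show "(if i = j then 1 else 0) +
      (\<Sum>p\<in>V. (if fst p = i then 1 else 0) * (A (fst p) j / real (m (fst p)))) =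
      (1 / lam i) * ((if i = j then lam i else 0) + A i j)"
      using lam_pos[OF i] by (auto simp: distrib_left)
  qed
  also have "\<dots> = (1 / \<Psi>) * fdet ?K (\<lambda>i j. (if i = j then lam i else 0) + A i j)"
    unfolding fdet_scale_rows by (simp add: assms(6) prod_dividef atLeast0LessThan)
  also have "fdet ?K (\<lambda>i j. (if i = j then lam i else 0) + A i j) =
      (\<Sum>S\<in>Pow ?K. fdet S A * (\<Prod>i\<in>?K - S. lam i))"
    by (rule fdet_add_diag) simp
  \<comment> \<open>The empty set contributes \<open>\<Psi>\<close>, since the empty determinant is
    1.\<close>
  also have "\<dots> = \<Psi> + (\<Sum>S\<in>Pow ?K - {{}}. fdet S A * (\<Prod>i\<in>?K - S. lam i))"
    by (subst sum.remove[of _ "{}"]) (auto simp: fdet_def assms(6) atLeast0LessThan)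
  also have "(\<Sum>S\<in>Pow ?K - {{}}. fdet S A * (\<Prod>i\<in>?K - S. lam i)) =
    (\<Sum>S\<in>{S. S \<subseteq> ?K \<and> S \<noteq> {}}.
        det (submatrix (compl_adj_mat k E) S S) * (\<Prod>i\<in>?K - S. lam i))"
  proof (rule sum.cong)
    fix S assume "S \<in> {S. S \<subseteq> ?K \<and> S \<noteq> {}}"
    then have S: "S \<subseteq> ?K" by simp
    have "det (submatrix (compl_adj_mat k E) S S) = fdet S (\<lambda>i j. compl_adj_mat k E $$ (i, j))"
      using S by (intro det_submatrix_eq_fdet) (auto simp: compl_adj_mat_def)
    also have "\<dots> = fdet S A"
      using S by (intro fdet_cong) (auto simp: compl_adj_mat_def A_def subset_iff)
    finally show "fdet S A * (\<Prod>i\<in>?K - S. lam i) =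
      det (submatrix (compl_adj_mat k E) S S) * (\<Prod>i\<in>?K - S. lam i)" by simp
  qed auto
  finally show ?thesis
    using \<open>n \<noteq> 0\<close> \<open>\<Psi> \<noteq> 0\<close> unfolding V_def by (simp add: field_simps)
qed

end
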